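(* Let $A\in\mathbb R^{n\times n}$ be the matrix with ones on the first superdiagonal and zeros elsewhere, $B=(0,\dots,0,1)'\in\mathbb R^n$ and $C=(1,0,\dots,0)$. Let $K_c$ (a row vector, $1\times n$) and $K_o$ (a column vector, $n\times1$) be such that $A+BK_c$ and $A+K_oC$ are Hurwitz. Then there exists a positive real number $\alpha^*$ such that for all $\alpha\in(0,\alpha^* )$ the following holds. For every $\delta>0$, set $L=\alpha/\delta$ and $\mathcal L=\mathrm{diag}(1/L,\dots,1/L^n)$, and let $$t_0=0,\qquad t_{k+1}=t_k+\delta,\qquad u_k=K_cL^{n+1}\mathcal L\,\hat x(t_k),\qquad k\in\mathbb N,$$ where $\hat x(t_0)\in\mathbb R^n$ is arbitrary, $$\dot{\hat x}(t)=A\hat x(t)+Bu_k\quad\forall t\in[t_k,t_{k+1}),\ k\in\mathbb N,$$ $$\hat x(t_k)=\hat x(t_k^-)+\delta\mathcal L^{-1}K_o\big(C\hat x(t_k^-)-y_k\big),\qquad k\ge1,$$ with $y_k=Cx(t_k)$, and where $x$ is the state of $\dot x(t)=Ax(t)+Bu(t)$ with $u(t)=u_k$ for $t\in[t_k,t_{k+1})$. Then $(x(t),\hat x(t))=0$ is a globally asymptotically stable solution of this closed-loop dynamical system.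
   Context: $\hat x(t_k^-)$ denotes the left limit of $\hat x$ at $t_k$; $x$ is continuous in time. A matrix is Hurwitz if all its eigenvalues have negative real part. $'$ denotes transposition. *)

theory Defs
  imports "HOL-Analysis.Analysis"
begin

definition eigenvalue :: "complex^'n^'n \<Rightarrow> complex \<Rightarrow> bool" where
  "eigenvalue M \<mu> \<longleftrightarrow> (\<exists>v. v \<noteq> 0 \<and> M *v v = \<mu> *s v)"

definition hurwitz :: "real^'n^'n \<Rightarrow> bool" where
  "hurwitz M \<longleftrightarrow> (\<forall>\<mu>. eigenvalue (map_matrix complex_of_real M) \<mu> \<longrightarrow> Re \<mu> < 0)"

text \<open>The index type is an arbitrary finite linear order with \<open>n = CARD('n)\<close> elements;
  \<open>idx\<close> is its order isomorphism onto \<open>{1..n}\<close>.  Row vectors (\<open>1 \<times> n\<close>) have type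
  \<open>real^'n^1\<close> and column vectors (\<open>n \<times> 1\<close>) have type \<open>real^1^'n\<close>.\<close>

definition idx :: "'n::{finite,linorder} \<Rightarrow> nat" where
  "idx i = card {..i}"

definition A_mat :: "real^'n::{finite,linorder}^'n::{finite,linorder}" where
  "A_mat = (\<chi> i j. if idx j = idx i + 1 then 1 else 0)"

definition B_mat :: "real^1^'n::{finite,linorder}" where
  "B_mat = (\<chi> i j. if idx i = CARD('n) then 1 else 0)"

definition C_mat :: "real^'n::{finite,linorder}^1" where
  "C_mat = (\<chi> i j. if idx j = 1 then 1 else 0)"

definition scaling :: "real \<Rightarrow> real^'n::{finite,linorder}^'n::{finite,linorder}" where
  "scaling L = (\<chi> i j. if i = j then 1 / L ^ idx i else 0)"

primrec sample_time :: "real \<Rightarrow> nat \<Rightarrow> real" where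
  "sample_time \<delta> 0 = 0"
| "sample_time \<delta> (Suc k) = sample_time \<delta> k + \<delta>"

text \<open>The held input \<open>u\<^sub>k\<close>, as a function of the observer state at the sampling time.\<close>

definition control :: "real^'n::{finite,linorder}^1 \<Rightarrow> real \<Rightarrow> real^'n::{finite,linorder} \<Rightarrow> real^1" where
  "control Kc L \<xi> = Kc *v (L ^ (CARD('n) + 1) *\<^sub>R (scaling L *v \<xi>))"

text \<open>Trajectories of the sampled-data closed loop on \<open>[0, \<infinity>)\<close>; values at negative times
  are irrelevant.  Taking derivatives within the half-open sampling interval makes them
  two-sided in its interior and right derivatives at the sampling time, where the input
  switches.  The estimate carries its post-jump value at a sampling time, and \<open>\<xi>\<close> below
  is its left limit there.\<close>

definition closed_loop ::
  "real^'n::{finite,linorder}^1 \<Rightarrow> real^1^'n::{finite,linorder} \<Rightarrow> real \<Rightarrow> real \<Rightarrow>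
    (real \<Rightarrow> (real^'n::{finite,linorder}) \<times> (real^'n::{finite,linorder})) set" where
  "closed_loop Kc Ko L \<delta> = {z.
     let x = (\<lambda>s. fst (z s)); xh = (\<lambda>s. snd (z s)); t = sample_time \<delta>;
         u = (\<lambda>k. control Kc L (xh (t k)))
     in continuous_on {0..} x \<and>
        (\<forall>k. \<forall>s\<in>{t k..<t (Suc k)}.
           (x has_vector_derivative (A_mat *v x s + B_mat *v u k))
             (at s within {t k..<t (Suc k)}) \<and>
           (xh has_vector_derivative (A_mat *v xh s + B_mat *v u k))
             (at s within {t k..<t (Suc k)})) \<and>
        (\<forall>k\<ge>1. \<exists>\<xi>. (xh \<longlongrightarrow> \<xi>) (at_left (t k)) \<and>
           xh (t k) = \<xi> + \<delta> *\<^sub>R (matrix_inv (scaling L) *v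
                              (Ko *v (C_mat *v \<xi> - C_mat *v x (t k)))))}"

text \<open>Global asymptotic stability of the zero solution, among the trajectories in \<open>S\<close>
  started at time \<open>0\<close>: Lyapunov stability together with global attractivity.\<close>

definition zero_globally_asymptotically_stable ::
  "(real \<Rightarrow> 'a::real_normed_vector) set \<Rightarrow> bool" where
  "zero_globally_asymptotically_stable S \<longleftrightarrow>
     (\<lambda>t. 0) \<in> S \<and>
     (\<forall>\<epsilon>>0. \<exists>\<eta>>0. \<forall>z\<in>S. norm (z 0) < \<eta> \<longrightarrow> (\<forall>t\<ge>0. norm (z t) < \<epsilon>)) \<and>
     (\<forall>z\<in>S. (z \<longlongrightarrow> 0) at_top)"

end

theory Submission
  imports Defs "HOL-Computational_Algebra.Fundamental_Theorem_Algebra"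
begin

text \<open>Let \<open>S\<close> be the scaling matrix, \<open>z = S x\<close> and \<open>e = S (\<xi> - x)\<close>, where \<open>\<xi>\<close> is the estimate. The
  flow after the \<open>k\<close>-th sample is \<open>z' = L (A z + B K\<^sub>c (z\<^sub>k + e\<^sub>k))\<close>, \<open>e' = L A e\<close>, and the jump is
  \<open>e \<mapsto> e + \<alpha> K\<^sub>o C e\<close>. One sampling period \<open>\<delta> = \<alpha> / L\<close> is therefore, up to an \<open>O(\<alpha>\<^sup>2)\<close>
  relative error, an Euler step of length \<open>\<alpha>\<close> for the cascade of \<open>A + K\<^sub>o C\<close> into \<open>A + B K\<^sub>c\<close>,
  independently of \<open>\<delta>\<close>. A Hurwitz matrix \<open>M\<close> admits a norm in which \<open>I + h M\<close> contracts by
  \<open>1 - c h\<close> for small \<open>h\<close>, and a weighted sum of two such norms decays geometrically along the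
  samples when \<open>\<alpha>\<close> is small.\<close>

section \<open>A contraction norm for a Hurwitz matrix\<close>

text \<open>This is \<open>p(M) v\<close>, evaluated by Horner's rule on the vector
  \<open>v\<close>, so that the matrix \<open>p(M)\<close> itself need not be formed.\<close>

definition matpoly :: "complex^'n^'n \<Rightarrow> complex poly \<Rightarrow> complex^'n \<Rightarrow> complex^'n" where
  "matpoly M p v = fold_coeffs (\<lambda>a w. a *s v + M *v w) p 0"

lemma matpoly_0 [simp]: "matpoly M 0 v = 0"
  by (simp add: matpoly_def)

lemma matpoly_pCons [simp]: "matpoly M (pCons a p) v = a *s v + M *v matpoly M p v"
  \<comment> \<open>\<open>fold_coeffs\<close> takes a step on \<open>pCons a p\<close> unless
    \<open>a\<close> and \<open>p\<close> are both 0; in that case both sides vanish.\<close>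
  by (cases "p = 0"; cases "a = 0") (simp_all add: matpoly_def)

lemma matpoly_add: "matpoly M (p + q) v = matpoly M p v + matpoly M q v"
  by (induction p q rule: poly_induct2)
    (simp_all add: matrix_vector_right_distrib vector_sadd_rdistrib)

lemma matpoly_smult: "matpoly M (smult c p) v = c *s matpoly M p v"
  by (induction p) (simp_all add: vector_add_ldistrib vector_scalar_commute vector_smult_assoc)

lemma matpoly_linear_factor:
  "matpoly M ([:- \<mu>, 1:] * q) v = M *v matpoly M q v - \<mu> *s matpoly M q v"
proof -
  have "[:- \<mu>, 1:] * q = pCons 0 q + smult (- \<mu>) q" by simp
  then show ?thesis
    by (simp only: matpoly_add matpoly_smult matpoly_pCons)
      (simp flip: diff_conv_add_uminus vector_sneg_minus1 add: vec_eq_iff)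
qed

text \<open>\<open>p(M)\<close> commutes with \<open>M\<close> and with scalars. This moves a linear
  factor from the outermost to the innermost position, where \<open>apply_factors\<close> consumes
  it.\<close>

lemma matpoly_commute:
  "matpoly M p (M *v v - \<mu> *s v) = M *v matpoly M p v - \<mu> *s matpoly M p v"
proof (induction p)
  case 0
  show ?case by simp
next
  case (pCons a p)
  have "a *s (M *v v - \<mu> *s v) = M *v (a *s v) - \<mu> *s (a *s v)"
    by (simp add: vector_scalar_commute vector_ssub_ldistrib vector_smult_assoc mult.commute)
  then show ?case
    by (simp add: pCons.IH matrix_vector_right_distrib matrix_vector_mult_diff_distrib
        vector_scalar_commute vector_add_ldistrib)
qed

fun apply_factors :: "complex^'n^'n \<Rightarrow> complex list \<Rightarrow> complex^'n \<Rightarrow> complex^'n" where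
  "apply_factors M [] v = v"
| "apply_factors M (\<mu> # \<mu>s) v = apply_factors M \<mu>s (M *v v - \<mu> *s v)"

lemma matpoly_prod_list:
  "matpoly M (\<Prod>\<mu>\<leftarrow>\<mu>s. [:- \<mu>, 1:]) v = apply_factors M \<mu>s v"
proof (induction \<mu>s arbitrary: v)
  case Nil
  show ?case by (simp add: one_pCons)
next
  case (Cons \<mu> \<mu>s)
  have "matpoly M (\<Prod>\<mu>\<leftarrow>\<mu> # \<mu>s. [:- \<mu>, 1:]) v
      = matpoly M (\<Prod>\<mu>\<leftarrow>\<mu>s. [:- \<mu>, 1:]) (M *v v - \<mu> *s v)"
    by (simp add: matpoly_linear_factor matpoly_commute del: mult_pCons_left)
  then show ?case by (simp add: Cons.IH del: mult_pCons_left)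
qed

section \<open>Existence of an annihilating polynomial\<close>

primrec matpow :: "complex^'n^'n \<Rightarrow> nat \<Rightarrow> complex^'n^'n" where
  "matpow M 0 = mat 1"
| "matpow M (Suc i) = M ** matpow M i"

lemma matpoly_monom: "matpoly M (monom a i) v = a *s (matpow M i *v v)"
  by (induction i)
    (simp_all add: monom_0 monom_Suc vector_scalar_commute matrix_vector_mul_assoc)

lemma matpoly_sum: "matpoly M (\<Sum>i\<in>I. p i) v = (\<Sum>i\<in>I. matpoly M (p i) v)"
  by (induction I rule: infinite_finite_induct) (simp_all add: matpoly_add)

text \<open>The first \<open>DIM('a) + 1\<close> terms are either distinct, and then too many to be
  independent, or two of them agree and their difference is the relation. Indexed coefficients treat
  both cases alike.\<close>

lemma sequence_linearly_dependent:
  fixes f :: "nat \<Rightarrow> 'a::euclidean_space"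
  obtains c :: "nat \<Rightarrow> real" and N k where "k \<le> N" "c k \<noteq> 0" "(\<Sum>i\<le>N. c i *\<^sub>R f i) = 0"
proof (cases "inj_on f {..DIM('a)}")
  case True
  then have "dependent (f ` {..DIM('a)})"
    by (intro dependent_biggerset) (simp add: card_image)
  then obtain u k where u: "(\<Sum>v\<in>f ` {..DIM('a)}. u v *\<^sub>R v) = 0" and "k \<le> DIM('a)" "u (f k) \<noteq> 0"
    by (auto simp: dependent_finite)
  then show ?thesis
    using that[of k "DIM('a)" "u \<circ> f"] True by (simp add: sum.reindex)
next
  case False
  then obtain i j where "i \<le> DIM('a)" "j \<le> DIM('a)" "i \<noteq> j" "f i = f j"
    by (auto simp: inj_on_def)
  have "(\<Sum>l\<le>DIM('a). (if l = i then 1 else if l = j then -1 else 0) *\<^sub>R f l)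
      = (\<Sum>l\<in>{i, j}. (if l = i then 1 else if l = j then -1 else 0) *\<^sub>R f l)"
    using \<open>i \<le> _\<close> \<open>j \<le> _\<close> by (intro sum.mono_neutral_right) auto
  also have "\<dots> = 0" using \<open>i \<noteq> j\<close> \<open>f i = f j\<close> by simp
  finally show ?thesis
    using that[of i "DIM('a)" "\<lambda>l. if l = i then 1 else if l = j then -1 else 0"] \<open>i \<le> _\<close> by simp
qed

lemma of_real_vector_smult: "complex_of_real c *s (v :: complex^'n) = c *\<^sub>R v"
  by (simp add: vec_eq_iff scaleR_conv_of_real[where 'a = complex])

lemma scaleR_matrix_vector: "(c *\<^sub>R (M :: complex^'n^'m)) *v v = c *\<^sub>R (M *v v)"
  by (simp add: vec_eq_iff matrix_vector_mult_def scaleR_sum_right)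

lemma sum_matrix_vector: "(\<Sum>i\<in>I. f i) *v v = (\<Sum>i\<in>I. f i *v (v :: complex^'n))"
  by (induction I rule: infinite_finite_induct) (simp_all add: matrix_vector_mult_add_rdistrib)

text \<open>The powers of \<open>M\<close> lie in a finite-dimensional real vector space, so
  finitely many of them satisfy a nontrivial real linear relation, whose coefficients are those of
  \<open>p\<close>.\<close>

lemma annihilating_polynomial_exists:
  fixes M :: "complex^'n^'n"
  obtains p where "p \<noteq> 0" "\<And>v. matpoly M p v = 0"
proof -
  obtain c :: "nat \<Rightarrow> real" and N k where k: "k \<le> N" "c k \<noteq> 0"
    and dep: "(\<Sum>i\<le>N. c i *\<^sub>R matpow M i) = 0"
    by (rule sequence_linearly_dependent)
  define p where "p = (\<Sum>i\<le>N. monom (complex_of_real (c i)) i)"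
  have "coeff p k = complex_of_real (c k)"
    using k by (simp add: p_def coeff_sum)
  with k have "p \<noteq> 0" by auto
  moreover have "matpoly M p v = 0" for v
  proof -
    have "matpoly M p v = (\<Sum>i\<le>N. c i *\<^sub>R matpow M i) *v v"
      by (simp add: p_def matpoly_sum matpoly_monom sum_matrix_vector of_real_vector_smult
          scaleR_matrix_vector)
    then show ?thesis using dep by simp
  qed
  ultimately show ?thesis by (rule that)
qed

text \<open>In an annihilating polynomial of least degree every root is an eigenvalue: dividing out
  the root leaves a polynomial that maps some vector to an eigenvector.\<close>

lemma annihilating_eigenvalues:
  fixes M :: "complex^'n^'n"
  obtains \<mu>s where "\<forall>\<mu>\<in>set \<mu>s. eigenvalue M \<mu>" "\<And>v. apply_factors M \<mu>s v = 0"
proof -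
  let ?P = "\<lambda>p. p \<noteq> 0 \<and> (\<forall>v. matpoly M p v = 0)"
  obtain p0 where "?P p0" by (metis annihilating_polynomial_exists)
  define p where "p = arg_min degree ?P"
  have p: "?P p" and p_min: "\<And>q. ?P q \<Longrightarrow> degree p \<le> degree q"
    using arg_min_nat_lemma[of ?P p0 degree] \<open>?P p0\<close> unfolding p_def by auto
  obtain R where R: "p = smult (lead_coeff p) (\<Prod>x\<in>#R. [:-x, 1:])"
    using alg_closed_imp_factorization p by blast
  obtain \<mu>s where \<mu>s: "mset \<mu>s = R" using ex_mset by blast
  have R': "p = smult (lead_coeff p) (\<Prod>x\<leftarrow>\<mu>s. [:-x, 1:])"
    using R unfolding \<mu>s[symmetric] by (simp flip: mset_map add: prod_mset_prod_list)
  have "apply_factors M \<mu>s v = 0" for v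
  proof -
    have "matpoly M p v = lead_coeff p *s apply_factors M \<mu>s v"
      by (subst R') (simp add: matpoly_smult matpoly_prod_list)
    with p show ?thesis by simp
  qed
  moreover have "eigenvalue M \<mu>" if "\<mu> \<in> set \<mu>s" for \<mu>
  proof -
    have "[:-\<mu>, 1:] dvd (\<Prod>x\<leftarrow>\<mu>s. [:-x, 1:])"
      using that by (intro prod_list_dvd) auto
    then have "[:-\<mu>, 1:] dvd p"
      by (subst R') (rule dvd_smult)
    then obtain q where q: "p = [:-\<mu>, 1:] * q" by (elim dvdE)
    with p have "q \<noteq> 0" by auto
    then have "degree p = Suc (degree q)"
      unfolding q by (subst degree_mult_eq) auto
    with p_min[of q] \<open>q \<noteq> 0\<close> obtain v where "matpoly M q v \<noteq> 0" by fastforce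
    moreover have "M *v matpoly M q v - \<mu> *s matpoly M q v = 0"
      using p unfolding q matpoly_linear_factor by blast
    ultimately show ?thesis unfolding eigenvalue_def by auto
  qed
  ultimately show ?thesis using that by blast
qed

text \<open>This is the sum of \<open>k ^ i * norm (w i)\<close> over
  \<open>i < length \<mu>s\<close>, where \<open>w 0 = v\<close> and each \<open>w (i + 1)\<close>
  is the image of \<open>w i\<close> under \<open>M\<close> minus the next root. It does the work of
  a Jordan basis with rescaled off-diagonal entries. The image under all factors is left out; it is
  0 for an annihilating list.\<close>

fun factor_norm :: "real \<Rightarrow> complex^'n^'n \<Rightarrow> complex list \<Rightarrow> complex^'n \<Rightarrow> real" where
  "factor_norm k M [] v = 0"
| "factor_norm k M (\<mu> # \<mu>s) v = norm v + k * factor_norm k M \<mu>s (M *v v - \<mu> *s v)"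

lemma norm_vector_smult: "norm (c *s (v :: complex^'n)) = cmod c * norm v"
  by (simp add: norm_vec_def norm_mult L2_set_right_distrib)

lemma factor_norm_add:
  assumes "k \<ge> 0"
  shows "factor_norm k M \<mu>s (v + w) \<le> factor_norm k M \<mu>s v + factor_norm k M \<mu>s w"
proof (induction \<mu>s arbitrary: v w)
  case (Cons \<mu> \<mu>s)
  have "M *v (v + w) - \<mu> *s (v + w) = (M *v v - \<mu> *s v) + (M *v w - \<mu> *s w)"
    by (simp add: matrix_vector_right_distrib vector_add_ldistrib)
  then have "k * factor_norm k M \<mu>s (M *v (v + w) - \<mu> *s (v + w))
      \<le> k * (factor_norm k M \<mu>s (M *v v - \<mu> *s v) + factor_norm k M \<mu>s (M *v w - \<mu> *s w))"
    using Cons.IH assms by (metis mult_left_mono)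
  then show ?case
    using norm_triangle_ineq[of v w] by (simp add: distrib_left)
qed simp

lemma factor_norm_nonneg: "k \<ge> 0 \<Longrightarrow> factor_norm k M \<mu>s v \<ge> 0"
  by (induction \<mu>s arbitrary: v) auto

lemma factor_norm_bounded:
  assumes "k \<ge> 0"
  obtains K where "K > 0" "\<And>v. factor_norm k M \<mu>s v \<le> K * norm v"
proof -
  have "\<exists>K>0. \<forall>v. factor_norm k M \<mu>s v \<le> K * norm v"
  proof (induction \<mu>s)
    case Nil
    show ?case by (intro exI[of _ 1]) auto
  next
    case (Cons \<mu> \<mu>s)
    then obtain K where K: "K > 0" "\<And>v. factor_norm k M \<mu>s v \<le> K * norm v" by blast
    have "linear (\<lambda>v. M *v v - \<mu> *s v)"
    proof (rule linearI)
      show "M *v (v + w) - \<mu> *s (v + w) = M *v v - \<mu> *s v + (M *v w - \<mu> *s w)" for v w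
        by (simp add: matrix_vector_right_distrib vector_add_ldistrib)
      show "M *v (r *\<^sub>R v) - \<mu> *s (r *\<^sub>R v) = r *\<^sub>R (M *v v - \<mu> *s v)" for r v
        unfolding of_real_vector_smult[symmetric] vector_scalar_commute vector_ssub_ldistrib
          vector_smult_assoc mult.commute[of \<mu>] by (rule refl)
    qed
    then obtain b where b: "b > 0" "\<And>v. norm (M *v v - \<mu> *s v) \<le> b * norm v"
      using linear_bounded_pos by blast
    have "factor_norm k M (\<mu> # \<mu>s) v \<le> (1 + k * K * b) * norm v" for v
    proof -
      have "factor_norm k M \<mu>s (M *v v - \<mu> *s v) \<le> K * (b * norm v)"
        using K b by (meson order_trans mult_left_mono less_imp_le)
      from mult_left_mono[OF this assms] show ?thesis by (simp add: algebra_simps)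
    qed
    moreover have "1 + k * K * b > 0"
      using assms K b by (intro add_pos_nonneg) auto
    ultimately show ?case by blast
  qed
  then show ?thesis using that by blast
qed

text \<open>An Euler step multiplies each summand by at most \<open>1 - c * h\<close> and adds
  \<open>h\<close> times the norm of the next image. That image carries one more factor
  \<open>k\<close> in the sum, so the total coupling is \<open>h / k\<close> times the sum without
  its first term. In the base case the annihilation hypothesis says \<open>v = 0\<close>, so the
  subtracted norm vanishes.\<close>

lemma factor_norm_contraction:
  fixes M :: "complex^'n^'n"
  assumes "k > 0" "h > 0"
    and "\<And>\<mu>. \<mu> \<in> set \<mu>s \<Longrightarrow> cmod (1 + of_real h * \<mu>) \<le> 1 - c * h"
    and "apply_factors M \<mu>s v = 0"
  shows "factor_norm k M \<mu>s (v + h *\<^sub>R (M *v v))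
    \<le> (1 - c * h) * factor_norm k M \<mu>s v + h / k * (factor_norm k M \<mu>s v - norm v)"
  using assms
proof (induction \<mu>s arbitrary: v)
  case Nil
  then show ?case by simp
next
  case (Cons \<mu> \<mu>s)
  define w where "w = M *v v - \<mu> *s v"
  let ?V = "factor_norm k M \<mu>s"
  have IH: "?V (w + h *\<^sub>R (M *v w)) \<le> (1 - c * h) * ?V w + h / k * (?V w - norm w)"
    using Cons by (simp add: w_def)
  have "v + h *\<^sub>R (M *v v) = (1 + of_real h * \<mu>) *s v + h *\<^sub>R w"
    by (simp add: w_def vec_eq_iff algebra_simps scaleR_conv_of_real[where 'a = complex])
  then have "norm (v + h *\<^sub>R (M *v v)) \<le> norm ((1 + of_real h * \<mu>) *s v) + norm (h *\<^sub>R w)"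
    by (simp only: norm_triangle_ineq)
  also have "\<dots> = cmod (1 + of_real h * \<mu>) * norm v + h * norm w"
    unfolding norm_vector_smult norm_scaleR using \<open>h > 0\<close> by simp
  also have "\<dots> \<le> (1 - c * h) * norm v + h * norm w"
    using Cons.prems by (simp add: mult_right_mono)
  finally have 1: "norm (v + h *\<^sub>R (M *v v)) \<le> (1 - c * h) * norm v + h * norm w" .
  \<comment> \<open>\<open>M - \<mu>\<close> commutes with \<open>I + h M\<close>, so the image of
    the step is the step of the image \<open>w\<close>, to which the induction hypothesis
    applies.\<close>
  have "M *v (v + h *\<^sub>R (M *v v)) - \<mu> *s (v + h *\<^sub>R (M *v v)) = w + h *\<^sub>R (M *v w)"
    by (simp add: w_def of_real_vector_smult[symmetric] matrix_vector_right_distrib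
      matrix_vector_mult_diff_distrib vector_scalar_commute vector_add_ldistrib
      vector_ssub_ldistrib vector_smult_assoc mult.commute)
  then have "factor_norm k M (\<mu> # \<mu>s) (v + h *\<^sub>R (M *v v))
      = norm (v + h *\<^sub>R (M *v v)) + k * ?V (w + h *\<^sub>R (M *v w))"
    by simp
  also have "\<dots> \<le> ((1 - c * h) * norm v + h * norm w)
      + k * ((1 - c * h) * ?V w + h / k * (?V w - norm w))"
    using 1 IH \<open>k > 0\<close> by (intro add_mono mult_left_mono) auto
  \<comment> \<open>The new coupling \<open>h * norm w\<close> cancels the \<open>- norm w\<close>
    supplied by the induction hypothesis.\<close>
  also have "\<dots> = (1 - c * h) * (norm v + k * ?V w) + h / k * (k * ?V w)"
    using \<open>k > 0\<close> by (simp add: field_simps)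
  finally show ?case by (simp add: w_def)
qed

text \<open>The squared modulus is \<open>1 + 2 h Re \<mu> + h^2 |\<mu>|^2\<close>. The real part
  contributes at most \<open>- 4 c h\<close>; the quadratic term gives back at most
  \<open>2 c h\<close>, and \<open>1 - 2 c h\<close> is below the square of
  \<open>1 - c h\<close>.\<close>

lemma cmod_one_plus_le:
  assumes "Re \<mu> \<le> - 2 * c" "c > 0" "h > 0" "h * (cmod \<mu>)\<^sup>2 \<le> 2 * c" "c * h \<le> 1"
  shows "cmod (1 + of_real h * \<mu>) \<le> 1 - c * h"
proof (rule power2_le_imp_le)
  have "(cmod (1 + of_real h * \<mu>))\<^sup>2 = 1 + 2 * h * Re \<mu> + h * (h * (cmod \<mu>)\<^sup>2)"
    unfolding cmod_power2 by (simp add: power2_eq_square algebra_simps)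
  also have "\<dots> \<le> 1 + 2 * h * (- 2 * c) + h * (2 * c)"
    using assms by (intro add_mono mult_left_mono) auto
  also have "\<dots> \<le> (1 - c * h)\<^sup>2"
    using assms by (simp add: power2_eq_square algebra_simps)
  finally show "(cmod (1 + of_real h * \<mu>))\<^sup>2 \<le> (1 - c * h)\<^sup>2" .
qed (use assms in auto)

lemma uniform_eigenvalue_contraction:
  assumes "finite S" "\<And>\<mu>. \<mu> \<in> S \<Longrightarrow> Re \<mu> < 0"
  obtains c h0 where "c > 0" "h0 > 0"
    "\<And>\<mu> h. \<mu> \<in> S \<Longrightarrow> 0 < h \<Longrightarrow> h < h0 \<Longrightarrow> cmod (1 + of_real h * \<mu>) \<le> 1 - c * h"
proof -
  \<comment> \<open>Inserting 1 keeps \<open>Min\<close> and \<open>Max\<close> meaningful for empty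
    \<open>S\<close>, and makes \<open>m\<close> a safe denominator.\<close>
  define c where "c = Min (insert 1 ((\<lambda>\<mu>. - Re \<mu> / 2) ` S))"
  define m where "m = Max (insert 1 ((\<lambda>\<mu>. (cmod \<mu>)\<^sup>2) ` S))"
  have c: "c > 0" "\<And>\<mu>. \<mu> \<in> S \<Longrightarrow> Re \<mu> \<le> - 2 * c"
  proof -
    show "c > 0" using assms unfolding c_def by (subst Min_gr_iff) auto
    fix \<mu> assume "\<mu> \<in> S"
    then have "c \<le> - Re \<mu> / 2" using assms(1) unfolding c_def by (intro Min_le) auto
    then show "Re \<mu> \<le> - 2 * c" by simp
  qed
  have m: "m \<ge> 1" "\<And>\<mu>. \<mu> \<in> S \<Longrightarrow> (cmod \<mu>)\<^sup>2 \<le> m"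
    using assms(1) unfolding m_def by (auto intro: Max_ge)
  show ?thesis
  proof (rule that[of c "min (2 * c / m) (1 / c)"])
    show "min (2 * c / m) (1 / c) > 0" using c m by simp
    fix \<mu> h assume \<mu>: "\<mu> \<in> S" and h: "0 < h" "h < min (2 * c / m) (1 / c)"
    have "h * (cmod \<mu>)\<^sup>2 \<le> h * m" using m \<mu> h by simp
    also have "\<dots> \<le> 2 * c" using h m by (simp add: field_simps)
    finally show "cmod (1 + of_real h * \<mu>) \<le> 1 - c * h"
      using c \<mu> h by (intro cmod_one_plus_le) (auto simp: field_simps)
  qed (rule c)
qed

text \<open>\<open>V\<close> is a Lyapunov function for all Euler steps \<open>I + h M\<close> with
  \<open>h < h0\<close>. It is norm-like rather than quadratic, so that perturbations are added by
  the triangle inequality.\<close>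

definition contraction_norm ::
  "real^'n^'n \<Rightarrow> (real^'n \<Rightarrow> real) \<Rightarrow> real \<Rightarrow> real \<Rightarrow> real \<Rightarrow> bool" where
  "contraction_norm M V c h0 K \<longleftrightarrow> c > 0 \<and> h0 > 0 \<and> K > 0 \<and>
     (\<forall>v w. V (v + w) \<le> V v + V w) \<and> (\<forall>v. norm v \<le> V v \<and> V v \<le> K * norm v) \<and>
     (\<forall>v h. 0 < h \<longrightarrow> h < h0 \<longrightarrow> V (v + h *\<^sub>R (M *v v)) \<le> (1 - c * h) * V v)"

text \<open>On the complexification, \<open>V\<close> is a weighted sum of the norms of the images of a vector
  under the partial products of \<open>\<Prod>\<^sub>i (M - \<mu>\<^sub>i)\<close>; geometric weights absorb the coupling
  between consecutive terms.\<close>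

lemma hurwitz_contraction_norm:
  fixes M :: "real^'n^'n"
  assumes "hurwitz M"
  shows "\<exists>V c h0 K. contraction_norm M V c h0 K"
proof -
  let ?M = "map_matrix complex_of_real M"
  define cvec :: "real^'n \<Rightarrow> complex^'n" where "cvec = (\<lambda>v. \<chi> i. complex_of_real (v $ i))"
  have norm_cvec: "norm (cvec v) = norm v" for v
    by (simp add: cvec_def norm_vec_def)
  have cvec_add: "cvec (v + w) = cvec v + cvec w" for v w
    by (simp add: cvec_def vec_eq_iff)
  have cvec_step: "cvec (v + h *\<^sub>R (M *v v)) = cvec v + h *\<^sub>R (?M *v cvec v)" for v h
    by (simp add: cvec_def vec_eq_iff matrix_vector_mult_def scaleR_conv_of_real[where 'a = complex])
  obtain \<mu>s where \<mu>s: "\<forall>\<mu>\<in>set \<mu>s. eigenvalue ?M \<mu>" "\<And>v. apply_factors ?M \<mu>s v = 0"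
    using annihilating_eigenvalues[where M = ?M] by blast
  obtain c h0 where ch: "c > 0" "h0 > 0"
    "\<And>\<mu> h. \<mu> \<in> set \<mu>s \<Longrightarrow> 0 < h \<Longrightarrow> h < h0 \<Longrightarrow> cmod (1 + of_real h * \<mu>) \<le> 1 - c * h"
    using assms \<mu>s uniform_eigenvalue_contraction[of "set \<mu>s"] unfolding hurwitz_def
    by (metis List.finite_set)
  \<comment> \<open>With this weight the coupling \<open>h / k\<close> equals
    \<open>c * h / 2\<close>, so half of the decay rate survives.\<close>
  define k where "k = 2 / c"
  have k: "k > 0" using ch by (simp add: k_def)
  define V where "V = (\<lambda>v. factor_norm k ?M \<mu>s (cvec v))"
  obtain K where K: "K > 0" "\<And>v. factor_norm k ?M \<mu>s v \<le> K * norm v"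
    using factor_norm_bounded k by (metis less_imp_le)
  have "contraction_norm M V (c / 2) h0 K"
    unfolding contraction_norm_def
  proof (intro conjI allI impI)
    show "c / 2 > 0" "h0 > 0" "K > 0" using ch K by auto
    show "V (v + w) \<le> V v + V w" for v w
      using k by (simp add: V_def cvec_add factor_norm_add)
    show "V v \<le> K * norm v" for v
      using K(2)[of "cvec v"] by (simp add: V_def norm_cvec)
    show "norm v \<le> V v" for v
    \<comment> \<open>For an empty list annihilation forces \<open>cvec v = 0\<close>; otherwise
      \<open>norm v\<close> is the first summand of \<open>V v\<close>.\<close>
    proof (cases \<mu>s)
      case Nil
      then have "cvec v = 0" using \<mu>s(2)[of "cvec v"] by simp
      then show ?thesis using Nil norm_cvec[of v] by (simp add: V_def)
    next
      case (Cons \<mu> \<mu>s')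
      then show ?thesis
        using k by (simp add: V_def norm_cvec factor_norm_nonneg)
    qed
    fix v h assume h: "0 < h" "h < h0"
    have "V (v + h *\<^sub>R (M *v v)) \<le> (1 - c * h) * V v + h / k * (V v - norm v)"
      unfolding V_def cvec_step norm_cvec[of v, symmetric]
      using ch h k \<mu>s by (intro factor_norm_contraction) auto
    also have "\<dots> \<le> (1 - c * h) * V v + h / k * V v"
      using h k by (intro add_left_mono mult_left_mono) auto
    also have "\<dots> = (1 - c / 2 * h) * V v"
      using ch by (simp add: k_def field_simps)
    finally show "V (v + h *\<^sub>R (M *v v)) \<le> (1 - c / 2 * h) * V v" .
  qed
  then show ?thesis by blast
qed

section \<open>The cascade of Euler steps\<close>

lemma perturbed_contraction:
  fixes V :: "'a::real_normed_vector \<Rightarrow> real"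
  assumes "\<And>v w. V (v + w) \<le> V v + V w" "\<And>v. V v \<le> K * norm v" "K \<ge> 0"
    and "V u \<le> q" "norm (v - u) \<le> r"
  shows "V v \<le> q + K * r"
proof -
  have "V v \<le> V u + V (v - u)" using assms(1)[of u "v - u"] by simp
  also have "V (v - u) \<le> K * r"
    using assms(2)[of "v - u"] assms(3,5) by (meson order_trans mult_left_mono)
  finally show ?thesis using assms(4) by simp
qed

text \<open>The error \<open>e\<close> evolves on its own and drives \<open>z\<close> through
  \<open>h F e\<close>. In \<open>V1 z + m * V2 e\<close> a large \<open>m\<close> lets the decay of
  \<open>e\<close> pay for this input, while the errors of order \<open>h^2\<close> are absorbed by
  taking \<open>h\<close> small.\<close>

lemma cascade_contraction:
  fixes A F G :: "real^'n^'n" and K :: real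
  assumes "hurwitz (A + F)" "hurwitz (A + G)" "K \<ge> 0"
  obtains W :: "real^'n \<Rightarrow> real^'n \<Rightarrow> real" and c h0 J where "c > 0" "h0 > 0" "J > 0" "c * h0 \<le> 1"
    "\<And>z e. norm z + norm e \<le> W z e" "\<And>z e. W z e \<le> J * (norm z + norm e)"
    "\<And>h z e z' e'. \<lbrakk>0 < h; h < h0;
        norm (z' - (z + h *\<^sub>R (A *v z + F *v (z + e)))) \<le> K * h\<^sup>2 * (norm z + norm e);
        norm (e' - (e + h *\<^sub>R (A *v e + G *v e))) \<le> K * h\<^sup>2 * norm e\<rbrakk>
      \<Longrightarrow> W z' e' \<le> (1 - c * h) * W z e"
proof -
  obtain V1 c1 h1 K1 where "contraction_norm (A + F) V1 c1 h1 K1"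
    using hurwitz_contraction_norm[OF assms(1)] by blast
  then have 1: "c1 > 0" "h1 > 0" "K1 > 0"
    "\<And>v w. V1 (v + w) \<le> V1 v + V1 w" "\<And>v. norm v \<le> V1 v" "\<And>v. V1 v \<le> K1 * norm v"
    "\<And>v h. 0 < h \<Longrightarrow> h < h1 \<Longrightarrow> V1 (v + h *\<^sub>R ((A + F) *v v)) \<le> (1 - c1 * h) * V1 v"
    unfolding contraction_norm_def by blast+
  obtain V2 c2 h2 K2 where "contraction_norm (A + G) V2 c2 h2 K2"
    using hurwitz_contraction_norm[OF assms(2)] by blast
  then have 2: "c2 > 0" "h2 > 0" "K2 > 0"
    "\<And>v w. V2 (v + w) \<le> V2 v + V2 w" "\<And>v. norm v \<le> V2 v" "\<And>v. V2 v \<le> K2 * norm v"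
    "\<And>v h. 0 < h \<Longrightarrow> h < h2 \<Longrightarrow> V2 (v + h *\<^sub>R ((A + G) *v v)) \<le> (1 - c2 * h) * V2 v"
    unfolding contraction_norm_def by blast+
  obtain f where f: "f > 0" "\<And>v. norm (F *v v) \<le> f * norm v"
    using linear_bounded_pos[of "(*v) F"] by auto
  have V_nonneg: "V1 v \<ge> 0" "V2 v \<ge> 0" for v
    using 1(5)[of v] 2(5)[of v] norm_ge_zero[of v] by linarith+
  \<comment> \<open>\<open>D\<close> bounds the gain from \<open>V2 e\<close> to
    \<open>V1 z'\<close> per unit of \<open>h\<close>, using \<open>h \<le> 1\<close>. The weight
    \<open>m\<close> is chosen so that \<open>D\<close> is at most
    \<open>m * c2 / 4\<close>.\<close>
  define D where "D = K1 * (f + K)"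
  define m where "m = 1 + 4 * D / c2"
  define c where "c = min (c1 / 2) (c2 / 4)"
  \<comment> \<open>The two fractions keep the second-order errors below half of each decay rate;
    the summand 1 in their denominators covers \<open>K = 0\<close>. The entry \<open>1 / c\<close>
    gives \<open>c * h0 \<le> 1\<close>.\<close>
  define h0 where "h0 = Min {1, h1, h2, c1 / (2 * (K1 * K + 1)), c2 / (2 * (K2 * K + 1)), 1 / c}"
  define W where "W = (\<lambda>z e. V1 z + m * V2 e)"
  have D: "D > 0" using 1 f assms by (simp add: D_def add_pos_nonneg)
  have m: "m \<ge> 1" "D \<le> m * (c2 / 4)" using D 2 by (auto simp: m_def field_simps)
  have c: "c > 0" "c \<le> c1 / 2" "c \<le> c2 / 4" using 1 2 by (auto simp: c_def)
  have pos: "K1 * K + 1 > 0" "K2 * K + 1 > 0"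
    using 1 2 assms by (simp_all add: add_nonneg_pos)
  have h0: "h0 > 0" using 1 2 c pos by (simp add: h0_def)
  have h0_le: "h0 \<le> 1" "h0 \<le> h1" "h0 \<le> h2" "h0 \<le> 1 / c"
      "h0 \<le> c1 / (2 * (K1 * K + 1))" "h0 \<le> c2 / (2 * (K2 * K + 1))"
    by (simp_all add: h0_def)
  show ?thesis
  proof (rule that[of c h0 "K1 + m * K2" W])
    show "c > 0" "h0 > 0" by (fact c h0)+
    show "K1 + m * K2 > 0" using 1 2 m by (simp add: add_pos_nonneg)
    show "c * h0 \<le> 1" using h0_le(4) c by (simp add: field_simps)
    fix z e :: "real^'n"
    have "V2 e \<le> m * V2 e" using m V_nonneg(2)[of e] by (simp add: mult_le_cancel_right1)
    then show "norm z + norm e \<le> W z e"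
      using 1(5)[of z] 2(5)[of e] by (simp add: W_def)
    have "V1 z + m * V2 e \<le> K1 * norm z + m * (K2 * norm e)"
      using 1(6)[of z] 2(6)[of e] m by (intro add_mono mult_left_mono) auto
    also have "\<dots> \<le> (K1 + m * K2) * (norm z + norm e)"
      using 1 2 m by (simp add: algebra_simps)
    finally show "W z e \<le> (K1 + m * K2) * (norm z + norm e)" by (simp add: W_def)
  next
    fix h z e z' e'
    assume h: "0 < h" "h < h0"
      and z': "norm (z' - (z + h *\<^sub>R (A *v z + F *v (z + e)))) \<le> K * h\<^sup>2 * (norm z + norm e)"
      and e': "norm (e' - (e + h *\<^sub>R (A *v e + G *v e))) \<le> K * h\<^sup>2 * norm e"
    have small: "K1 * K * h \<le> c1 / 2" "K2 * K * h \<le> c2 / 2"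
    proof -
      have "h \<le> c1 / (2 * (K1 * K + 1))" "h \<le> c2 / (2 * (K2 * K + 1))" using h h0_le by linarith+
      then have "h * (2 * (K1 * K + 1)) \<le> c1" "h * (2 * (K2 * K + 1)) \<le> c2"
        using pos by (simp_all add: pos_le_divide_eq)
      then show "K1 * K * h \<le> c1 / 2" "K2 * K * h \<le> c2 / 2"
        using h by (simp_all add: algebra_simps)
    qed
    have h1: "h < h1" "h < h2" "h \<le> 1" using h h0_le by auto
    have "norm (z' - (z + h *\<^sub>R ((A + F) *v z)))
        = norm ((z' - (z + h *\<^sub>R (A *v z + F *v (z + e)))) + h *\<^sub>R (F *v e))"
      by (simp add: algebra_simps matrix_vector_right_distrib matrix_vector_mult_add_rdistrib)
    also have "\<dots> \<le> K * h\<^sup>2 * (norm z + norm e) + h * (f * norm e)"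
      using z' f(2)[of e] h by (intro norm_triangle_mono) auto
    also have "\<dots> \<le> K * h\<^sup>2 * (V1 z + V2 e) + h * (f * V2 e)"
      using 1(5)[of z] 2(5)[of e] assms(3) f h by (intro add_mono mult_left_mono) auto
    finally have "V1 z' \<le> (1 - c1 * h) * V1 z + K1 * (K * h\<^sup>2 * (V1 z + V2 e) + h * (f * V2 e))"
      using 1 h h1 by (intro perturbed_contraction[OF 1(4) 1(6), where u = "z + h *\<^sub>R ((A + F) *v z)"]) auto
    also have "\<dots> = (1 - c1 * h) * V1 z + h * (K1 * K * h) * V1 z + h * (K1 * (f + K * h)) * V2 e"
      by (simp add: algebra_simps power2_eq_square)
    also have "\<dots> \<le> (1 - c1 * h) * V1 z + h * (c1 / 2) * V1 z + h * D * V2 e"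
      unfolding D_def using small h h1 V_nonneg 1 f assms(3)
      by (intro add_mono mult_right_mono mult_left_mono) (auto simp: mult_left_le)
    finally have V1: "V1 z' \<le> (1 - c1 / 2 * h) * V1 z + h * D * V2 e"
      by (simp add: algebra_simps)
    have "norm (e' - (e + h *\<^sub>R ((A + G) *v e))) \<le> K * h\<^sup>2 * norm e"
      using e' by (simp add: matrix_vector_mult_add_rdistrib)
    also have "\<dots> \<le> K * h\<^sup>2 * V2 e"
      using 2(5)[of e] assms(3) by (intro mult_left_mono) auto
    finally have "V2 e' \<le> (1 - c2 * h) * V2 e + K2 * (K * h\<^sup>2 * V2 e)"
      using 2 h h1 by (intro perturbed_contraction[OF 2(4) 2(6), where u = "e + h *\<^sub>R ((A + G) *v e)"]) auto
    also have "\<dots> = (1 - c2 * h) * V2 e + h * (K2 * K * h) * V2 e"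
      by (simp add: algebra_simps power2_eq_square)
    also have "\<dots> \<le> (1 - c2 * h) * V2 e + h * (c2 / 2) * V2 e"
      using small h V_nonneg by (intro add_mono mult_right_mono mult_left_mono) auto
    finally have V2: "V2 e' \<le> (1 - c2 / 2 * h) * V2 e"
      by (simp add: algebra_simps)
    have "W z' e' \<le> (1 - c1 / 2 * h) * V1 z + h * D * V2 e + m * ((1 - c2 / 2 * h) * V2 e)"
      unfolding W_def using V1 V2 m by (intro add_mono mult_left_mono) auto
    \<comment> \<open>Of the remaining rate \<open>c2 / 2\<close> one half pays for the coupling and
      \<open>c2 / 4\<close> is left.\<close>
    also have "\<dots> \<le> (1 - c1 / 2 * h) * V1 z + h * (m * (c2 / 4)) * V2 e
        + m * ((1 - c2 / 2 * h) * V2 e)"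
      using m h V_nonneg by (intro add_mono mult_right_mono mult_left_mono) auto
    also have "\<dots> = (1 - c1 / 2 * h) * V1 z + (1 - c2 / 4 * h) * (m * V2 e)"
      by (simp add: algebra_simps)
    also have "\<dots> \<le> (1 - c * h) * V1 z + (1 - c * h) * (m * V2 e)"
      using c h m V_nonneg by (intro add_mono mult_right_mono diff_left_mono) auto
    finally show "W z' e' \<le> (1 - c * h) * W z e" by (simp add: W_def algebra_simps)
  qed
qed

section \<open>Flow between sampling times\<close>

text \<open>A self-consistent estimate replaces the matrix exponential. If \<open>m\<close> is the
  largest deviation from \<open>y t0\<close> on \<open>[t0, s]\<close>, the deviation from the Euler
  line is at most \<open>h a m\<close>. Hence \<open>m \<le> h a m + h N\<close>, and
  \<open>a h \<le> 1 / 2\<close> gives \<open>m \<le> 2 h N\<close>. Reinserting this makes the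
  Euler error quadratic in \<open>h\<close>.\<close>

lemma affine_flow_bounds:
  fixes y :: "real \<Rightarrow> 'a::real_normed_vector"
  assumes "linear A" "\<And>v. norm (A v) \<le> a * norm v"
    and "a \<ge> 0" "L > 0" "a * (L * (t1 - t0)) \<le> 1 / 2"
    and deriv: "\<And>s. s \<in> {t0..<t1} \<Longrightarrow>
      (y has_vector_derivative L *\<^sub>R (A (y s) + b)) (at s within {t0..<t1})"
    and s: "s \<in> {t0..<t1}"
  shows "norm (y s - y t0) \<le> 2 * (L * (t1 - t0)) * (a * norm (y t0) + norm b)"
    and "norm (y s - y t0 - (L * (s - t0)) *\<^sub>R (A (y t0) + b))
      \<le> 2 * a * (L * (t1 - t0))\<^sup>2 * (a * norm (y t0) + norm b)"
proof -
  define h where "h = L * (t1 - t0)"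
  define N where "N = a * norm (y t0) + norm b"
  have h: "h \<ge> 0" "a * h \<le> 1 / 2" using assms by (auto simp: h_def)
  \<comment> \<open>The maximum is taken on \<open>[t0, s]\<close> with \<open>s < t1\<close>, since
    \<open>y\<close> may jump at \<open>t1\<close>.\<close>
  have "continuous_on {t0..s} y"
  proof (rule continuous_on_vector_derivative)
    show "(y has_vector_derivative L *\<^sub>R (A (y x) + b)) (at x within {t0..s})" if "x \<in> {t0..s}" for x
      using that s by (intro has_vector_derivative_within_subset[OF deriv]) auto
  qed
  then have "continuous_on {t0..s} (\<lambda>r. norm (y r - y t0))"
    by (intro continuous_intros)
  then have "\<exists>r\<in>{t0..s}. \<forall>q\<in>{t0..s}. norm (y q - y t0) \<le> norm (y r - y t0)"
    using s by (intro continuous_attains_sup) auto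
  then obtain r where r: "r \<in> {t0..s}"
    and max: "\<And>q. q \<in> {t0..s} \<Longrightarrow> norm (y q - y t0) \<le> norm (y r - y t0)"
    by blast
  define m where "m = norm (y r - y t0)"
  have lin: "norm (y q - y t0 - (L * (q - t0)) *\<^sub>R (A (y t0) + b)) \<le> h * a * m"
    if q: "q \<in> {t0..s}" for q
  proof -
    have "norm (y q - y t0 - (q - t0) *\<^sub>R (L *\<^sub>R (A (y t0) + b))) \<le> norm (q - t0) * (L * (a * m))"
    proof (rule vector_differentiable_bound_linearization[of "{t0..s}" _ "\<lambda>x. L *\<^sub>R (A (y x) + b)"])
      show "(y has_vector_derivative L *\<^sub>R (A (y x) + b)) (at x within {t0..s})"
        if "x \<in> {t0..s}" for x
        using that s by (intro has_vector_derivative_within_subset[OF deriv]) auto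
      show "closed_segment t0 q \<subseteq> {t0..s}" using q by (auto simp: closed_segment_eq_real_ivl)
      fix x assume x: "x \<in> {t0..s}"
      have "norm (A (y x - y t0)) \<le> a * m"
        using assms(2)[of "y x - y t0"] max[OF x] \<open>a \<ge> 0\<close> unfolding m_def
        by (meson order_trans mult_left_mono)
      then show "norm (L *\<^sub>R (A (y x) + b) - L *\<^sub>R (A (y t0) + b)) \<le> L * (a * m)"
        using \<open>L > 0\<close> by (simp add: linear_diff[OF \<open>linear A\<close>] flip: scaleR_diff_right)
    qed (use s in auto)
    also have "\<dots> \<le> (t1 - t0) * (L * (a * m))"
      using q s assms by (intro mult_right_mono) (auto simp: m_def)
    finally show ?thesis by (simp add: h_def mult_ac)
  qed
  have A0: "norm (A (y t0) + b) \<le> N"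
    unfolding N_def using assms(2) by (intro norm_triangle_mono) auto
  have "(L * (r - t0)) * norm (A (y t0) + b) \<le> h * N"
    using r s A0 assms(4) unfolding h_def by (intro mult_mono) auto
  then have "norm ((L * (r - t0)) *\<^sub>R (A (y t0) + b)) \<le> h * N"
    using r \<open>L > 0\<close> by simp
  then have "m \<le> h * a * m + h * N"
    using lin[OF r] norm_triangle_sub[of "y r - y t0" "(L * (r - t0)) *\<^sub>R (A (y t0) + b)"]
    by (simp add: m_def)
  also have "h * a * m \<le> 1 / 2 * m"
    using h by (intro mult_right_mono) (auto simp: m_def mult.commute)
  finally have m: "m \<le> 2 * h * N" by simp
  show "norm (y s - y t0) \<le> 2 * (L * (t1 - t0)) * (a * norm (y t0) + norm b)"
    using max[of s] s m by (simp add: h_def N_def m_def)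
  have "h * a * m \<le> h * a * (2 * h * N)"
    using m h \<open>a \<ge> 0\<close> by (intro mult_left_mono) auto
  then show "norm (y s - y t0 - (L * (s - t0)) *\<^sub>R (A (y t0) + b))
      \<le> 2 * a * (L * (t1 - t0))\<^sup>2 * (a * norm (y t0) + norm b)"
    using lin[of s] s by (simp add: h_def N_def power2_eq_square algebra_simps)
qed

text \<open>The error bound does not depend on \<open>s\<close>, so it passes to the limit. The
  limit \<open>\<xi>\<close> is the value before the jump and may differ from
  \<open>y t1\<close>.\<close>

lemma affine_flow_left_limit:
  fixes y :: "real \<Rightarrow> 'a::real_normed_vector"
  assumes "linear A" "\<And>v. norm (A v) \<le> a * norm v"
    and "a \<ge> 0" "L > 0" "a * (L * (t1 - t0)) \<le> 1 / 2" "t0 < t1"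
    and "\<And>s. s \<in> {t0..<t1} \<Longrightarrow>
      (y has_vector_derivative L *\<^sub>R (A (y s) + b)) (at s within {t0..<t1})"
    and lim: "(y \<longlongrightarrow> \<xi>) (at_left t1)"
  shows "norm (\<xi> - (y t0 + (L * (t1 - t0)) *\<^sub>R (A (y t0) + b)))
      \<le> 2 * a * (L * (t1 - t0))\<^sup>2 * (a * norm (y t0) + norm b)"
proof -
  have "((\<lambda>s. y s - y t0 - (L * (s - t0)) *\<^sub>R (A (y t0) + b))
      \<longlongrightarrow> \<xi> - y t0 - (L * (t1 - t0)) *\<^sub>R (A (y t0) + b)) (at_left t1)"
    by (intro tendsto_intros lim)
  moreover have "\<forall>\<^sub>F s in at_left t1. norm (y s - y t0 - (L * (s - t0)) *\<^sub>R (A (y t0) + b))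
      \<le> 2 * a * (L * (t1 - t0))\<^sup>2 * (a * norm (y t0) + norm b)"
    unfolding eventually_at_left_field
    using \<open>t0 < t1\<close> affine_flow_bounds(2)[OF assms(1-5,7)] by (intro exI[of _ t0]) auto
  ultimately show ?thesis
    using Lim_norm_ubound[OF trivial_limit_at_left_real] by (simp add: algebra_simps)
qed

section \<open>The closed loop in scaled coordinates\<close>

lemma scaling_nth [simp]:
  fixes v :: "real^'n::{finite,linorder}"
  shows "(scaling L *v v) $ i = v $ i / L ^ idx i"
proof -
  have "(scaling L *v v) $ i = (\<Sum>j\<in>UNIV. if i = j then v $ j / L ^ idx j else 0)"
    unfolding scaling_def matrix_vector_mult_def vec_lambda_beta by (intro sum.cong) auto
  then show ?thesis by simp
qed

lemma A_mat_nth: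
  "(A_mat *v v) $ i = (\<Sum>j\<in>UNIV. if idx j = idx i + 1 then v $ j else 0)"
  unfolding A_mat_def matrix_vector_mult_def vec_lambda_beta by (intro sum.cong) auto

lemma B_mat_nth:
  fixes i :: "'n::{finite,linorder}"
  shows "(B_mat *v u) $ i = (if idx i = CARD('n) then u $ 1 else 0)"
  by (simp add: B_mat_def matrix_vector_mult_def)

lemma C_mat_nth:
  "(C_mat *v v) $ i = (\<Sum>j\<in>UNIV. if idx j = 1 then v $ j else 0)"
  unfolding C_mat_def matrix_vector_mult_def vec_lambda_beta by (intro sum.cong) auto

text \<open>Row \<open>i\<close> of the shift reads the next entry, which the scaling on the right
  divides by one more power of \<open>L\<close>.\<close>

lemma scaling_A_mat:
  fixes v :: "real^'n::{finite,linorder}"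
  assumes "L > 0"
  shows "scaling L *v (A_mat *v v) = L *\<^sub>R (A_mat *v (scaling L *v v))"
  using assms
  by (auto simp: vec_eq_iff A_mat_nth sum_divide_distrib sum_distrib_left intro!: sum.cong)

lemma scaling_B_mat:
  "scaling L *v (B_mat *v u) = (1 / L ^ CARD('n)) *\<^sub>R (B_mat *v u :: real^'n::{finite,linorder})"
  by (simp add: vec_eq_iff B_mat_nth)

lemma scaling_C_mat:
  fixes v :: "real^'n::{finite,linorder}"
  assumes "L > 0"
  shows "C_mat *v v = L *\<^sub>R (C_mat *v (scaling L *v v))"
  using assms by (auto simp: vec_eq_iff C_mat_nth sum_distrib_left intro!: sum.cong)

lemma invertible_scaling:
  assumes "L > 0"
  shows "invertible (scaling L :: real^'n::{finite,linorder}^'n::{finite,linorder})"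
proof -
  let ?S = "scaling L :: real^'n::{finite,linorder}^'n::{finite,linorder}"
  have "\<forall>v. ?S *v v = 0 \<longrightarrow> v = 0"
    using assms by (simp add: vec_eq_iff)
  then show ?thesis
    by (simp add: invertible_left_inverse matrix_left_invertible_ker)
qed

lemma scaling_matrix_inv:
  fixes v :: "real^'n::{finite,linorder}"
  assumes "L > 0"
  shows "scaling L *v (matrix_inv (scaling L) *v v) = v"
    and "matrix_inv (scaling L) *v (scaling L *v v) = v"
proof -
  let ?S = "scaling L :: real^'n::{finite,linorder}^'n::{finite,linorder}"
  have "\<exists>T. ?S ** T = mat 1 \<and> T ** ?S = mat 1"
    using invertible_scaling[OF assms] unfolding invertible_def .
  then have "?S ** matrix_inv ?S = mat 1 \<and> matrix_inv ?S ** ?S = mat 1"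
    unfolding matrix_inv_def by (rule someI_ex)
  then show "scaling L *v (matrix_inv (scaling L) *v v) = v"
    and "matrix_inv (scaling L) *v (scaling L *v v) = v"
    by (simp_all add: matrix_vector_mul_assoc)
qed

text \<open>The input acts on the last coordinate, scaled by \<open>1 / L ^ n\<close>; the gain
  factor \<open>L ^ (n + 1)\<close> leaves exactly one \<open>L\<close>, the same factor as for
  \<open>A_mat\<close>. Thus \<open>L\<close> only rescales time.\<close>

lemma scaling_control:
  fixes \<xi> :: "real^'n::{finite,linorder}" and Kc :: "real^'n::{finite,linorder}^1"
  assumes "L > 0"
  shows "scaling L *v ((B_mat :: real^1^'n::{finite,linorder}) *v control Kc L \<xi>) = L *\<^sub>R ((B_mat ** Kc) *v (scaling L *v \<xi>))"
  using assms
  by (simp add: scaling_B_mat control_def matrix_vector_mult_scaleR flip: matrix_vector_mul_assoc)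

section \<open>Sampling times, and stability from geometric decay\<close>

lemma sample_time_eq: "sample_time \<delta> k = real k * \<delta>"
  by (induction k) (simp_all add: algebra_simps)

lemma sample_interval:
  assumes "\<delta> > 0" "s \<ge> 0"
  shows "s \<in> {sample_time \<delta> (nat \<lfloor>s / \<delta>\<rfloor>)..<sample_time \<delta> (Suc (nat \<lfloor>s / \<delta>\<rfloor>))}"
proof -
  have "real (nat \<lfloor>s / \<delta>\<rfloor>) = of_int \<lfloor>s / \<delta>\<rfloor>" using assms by simp
  then show ?thesis
    using floor_divide_lower[OF assms(1), of s] floor_divide_upper[OF assms(1), of s]
    by (simp add: sample_time_eq add.commute del: sample_time.simps)
qed

text \<open>Every time \<open>t \<ge> 0\<close> lies in the interval with index
  \<open>nat \<lfloor>t / \<delta>\<rfloor>\<close>. Since the bound is linear in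
  \<open>norm (z 0)\<close> and \<open>q ^ k \<le> 1\<close>, the choice
  \<open>\<epsilon> / R\<close> gives stability; attractivity follows because the index tends to
  infinity.\<close>

lemma exponential_decay_imp_stable:
  assumes "(\<lambda>t. 0) \<in> S" "\<delta> > 0" "0 < q" "q < 1" "R > 0"
    and decay: "\<And>z k s. z \<in> S \<Longrightarrow> s \<in> {sample_time \<delta> k..<sample_time \<delta> (Suc k)} \<Longrightarrow>
      norm (z s) \<le> R * q ^ k * norm (z 0)"
  shows "zero_globally_asymptotically_stable S"
  unfolding zero_globally_asymptotically_stable_def
proof (intro conjI allI impI ballI)
  show "(\<lambda>t. 0) \<in> S" by fact
next
  fix \<epsilon> :: real assume "\<epsilon> > 0"
  show "\<exists>\<eta>>0. \<forall>z\<in>S. norm (z 0) < \<eta> \<longrightarrow> (\<forall>t\<ge>0. norm (z t) < \<epsilon>)"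
  proof (intro exI[of _ "\<epsilon> / R"] conjI ballI impI allI)
    show "\<epsilon> / R > 0" using \<open>\<epsilon> > 0\<close> \<open>R > 0\<close> by simp
    fix z and t :: real assume z: "z \<in> S" "norm (z 0) < \<epsilon> / R" and "t \<ge> 0"
    have "norm (z t) \<le> R * q ^ nat \<lfloor>t / \<delta>\<rfloor> * norm (z 0)"
      using decay[OF z(1) sample_interval] \<open>t \<ge> 0\<close> \<open>\<delta> > 0\<close> by blast
    also have "\<dots> \<le> R * 1 * norm (z 0)"
      using assms by (intro mult_right_mono mult_left_mono power_le_one) auto
    also have "\<dots> < \<epsilon>" using z \<open>R > 0\<close> by (simp add: pos_less_divide_eq mult.commute)
    finally show "norm (z t) < \<epsilon>" .
  qed
next
  fix z assume z: "z \<in> S"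
  have "(\<lambda>k. R * q ^ k * norm (z 0)) \<longlonglongrightarrow> R * 0 * norm (z 0)"
    using assms by (intro tendsto_intros LIMSEQ_power_zero) auto
  moreover have "filterlim (\<lambda>t. nat \<lfloor>t / \<delta>\<rfloor>) sequentially at_top"
  proof -
    have "filterlim (\<lambda>t. t / \<delta>) at_top at_top"
      using \<open>\<delta> > 0\<close> by (subst divide_inverse)
        (intro filterlim_at_top_mult_tendsto_pos[OF tendsto_const] filterlim_ident, simp_all)
    then show ?thesis
      by (intro filterlim_compose[OF filterlim_nat_sequentially]
        filterlim_compose[OF filterlim_floor_sequentially])
  qed
  ultimately have "((\<lambda>t. R * q ^ nat \<lfloor>t / \<delta>\<rfloor> * norm (z 0)) \<longlongrightarrow> 0) at_top"
    by (auto dest: filterlim_compose)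
  moreover have "\<forall>\<^sub>F t in at_top. norm (z t) \<le> R * q ^ nat \<lfloor>t / \<delta>\<rfloor> * norm (z 0)"
    using eventually_ge_at_top[of 0]
    by eventually_elim (use decay[OF z sample_interval] \<open>\<delta> > 0\<close> in blast)
  ultimately show "(z \<longlongrightarrow> 0) at_top"
    by (rule Lim_null_comparison[rotated])
qed

section \<open>One sampling period of the closed loop\<close>

lemma zero_in_closed_loop: "(\<lambda>t. 0) \<in> closed_loop Kc Ko L \<delta>"
  by (auto simp: closed_loop_def Let_def control_def matrix_vector_mult_0_right)

text \<open>In scaled coordinates both flows are affine with speed \<open>L\<close>, so over one
  period they are Euler steps of length \<open>h = L * \<delta>\<close> up to second order. The jump
  adds the term \<open>h K_o C\<close>, evaluated at the pre-jump error; replacing that by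
  \<open>e (t k)\<close> again costs only second order.\<close>

lemma closed_loop_sampling_interval:
  fixes Kc :: "real^'n::{finite,linorder}^1" and Ko :: "real^1^'n::{finite,linorder}"
    and w :: "real \<Rightarrow> (real^'n::{finite,linorder}) \<times> (real^'n::{finite,linorder})" and k :: nat
  assumes w: "w \<in> closed_loop Kc Ko L \<delta>" and pos: "L > 0" "\<delta> > 0"
    and A: "\<And>v :: real^'n::{finite,linorder}. norm (A_mat *v v) \<le> a * norm v" "a \<ge> 0" "a * (L * \<delta>) \<le> 1 / 2"
    and F: "\<And>v. norm ((B_mat ** Kc :: real^'n::{finite,linorder}^'n::{finite,linorder}) *v v) \<le> f * norm v" "f \<ge> 0"
    and G: "\<And>v. norm ((Ko ** C_mat :: real^'n::{finite,linorder}^'n::{finite,linorder}) *v v) \<le> g * norm v" "g \<ge> 0"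
    and h_def: "h = L * \<delta>" and t_def: "t = sample_time \<delta>"
    and z_def: "z = (\<lambda>s. scaling L *v fst (w s))"
    and e_def: "e = (\<lambda>s. scaling L *v (snd (w s) - fst (w s)))"
  shows "\<And>s. s \<in> {t k..<t (Suc k)} \<Longrightarrow>
      norm (z s) + norm (e s) \<le> (1 + 2 * h * (a + f)) * (norm (z (t k)) + norm (e (t k)))"
    and "norm (z (t (Suc k)) - (z (t k) + h *\<^sub>R (A_mat *v z (t k) + (B_mat ** Kc) *v (z (t k) + e (t k)))))
      \<le> 2 * a * (a + f + g) * h\<^sup>2 * (norm (z (t k)) + norm (e (t k)))"
    and "norm (e (t (Suc k)) - (e (t k) + h *\<^sub>R (A_mat *v e (t k) + (Ko ** C_mat) *v e (t k))))
      \<le> 2 * a * (a + f + g) * h\<^sup>2 * norm (e (t k))"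
proof -
  let ?S = "scaling L :: real^'n::{finite,linorder}^'n::{finite,linorder}"
  let ?I = "{t k..<t (Suc k)}"
  let ?A = "A_mat :: real^'n::{finite,linorder}^'n::{finite,linorder}"
  define b where "b = (B_mat ** Kc :: real^'n::{finite,linorder}^'n::{finite,linorder}) *v (z (t k) + e (t k))"
  define u where "u = control Kc L (snd (w (t k)))"
  define x where "x = (\<lambda>s. fst (w s))"
  define xh where "xh = (\<lambda>s. snd (w s))"
  have cont: "continuous_on {0..} x"
    and dx: "\<And>s. s \<in> ?I \<Longrightarrow> (x has_vector_derivative (A_mat *v x s + B_mat *v u)) (at s within ?I)"
    and dxh: "\<And>s. s \<in> ?I \<Longrightarrow> (xh has_vector_derivative (A_mat *v xh s + B_mat *v u)) (at s within ?I)"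
    using w by (simp_all add: closed_loop_def Let_def x_def xh_def t_def u_def)
  have "\<exists>\<xi>. (xh \<longlongrightarrow> \<xi>) (at_left (t (Suc k))) \<and> xh (t (Suc k)) =
      \<xi> + \<delta> *\<^sub>R (matrix_inv ?S *v (Ko *v (C_mat *v \<xi> - C_mat *v x (t (Suc k)))))"
    using w by (simp add: closed_loop_def Let_def x_def xh_def t_def del: sample_time.simps)
  then obtain \<xi> where \<xi>: "(xh \<longlongrightarrow> \<xi>) (at_left (t (Suc k)))"
    and jump: "xh (t (Suc k)) =
      \<xi> + \<delta> *\<^sub>R (matrix_inv ?S *v (Ko *v (C_mat *v \<xi> - C_mat *v x (t (Suc k)))))"
    by blast
  have t: "t (Suc k) - t k = \<delta>" "t k < t (Suc k)" "t (Suc k) > 0" "t k \<in> ?I"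
    using pos by (auto simp: t_def sample_time_eq algebra_simps add_pos_nonneg)
  have h: "h > 0" using pos by (simp add: h_def)
  have hA: "a * h \<le> 1 / 2" using A(3) by (simp add: h_def)
  have zk: "z (t k) + e (t k) = ?S *v snd (w (t k))"
    by (simp add: z_def e_def flip: matrix_vector_right_distrib)
  have flow: "?S *v (A_mat *v v + B_mat *v u) = L *\<^sub>R (A_mat *v (?S *v v) + b)" for v
    using pos
    by (simp add: b_def u_def zk matrix_vector_right_distrib scaling_A_mat scaling_control
        scaleR_add_right)
  have dz: "(z has_vector_derivative L *\<^sub>R (A_mat *v z s + b)) (at s within ?I)" if "s \<in> ?I" for s
    using bounded_linear.has_vector_derivative[OF matrix_vector_mul_bounded_linear dx[OF that], of ?S]
    unfolding flow by (simp add: z_def x_def)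
  \<comment> \<open>Plant and observer receive the same held input, which cancels in the
    error.\<close>
  have de: "(e has_vector_derivative L *\<^sub>R (A_mat *v e s + 0)) (at s within ?I)" if "s \<in> ?I" for s
  proof -
    have "A_mat *v xh s + B_mat *v u - (A_mat *v x s + B_mat *v u) = A_mat *v (xh s - x s)"
      by (simp add: matrix_vector_mult_diff_distrib)
    then have "((\<lambda>s. xh s - x s) has_vector_derivative A_mat *v (xh s - x s)) (at s within ?I)"
      using has_vector_derivative_diff[OF dxh[OF that] dx[OF that]] by simp
    from bounded_linear.has_vector_derivative[OF matrix_vector_mul_bounded_linear this, of ?S]
    show ?thesis using pos by (simp add: e_def x_def xh_def scaling_A_mat)
  qed
  have b: "norm b \<le> f * (norm (z (t k)) + norm (e (t k)))"
    unfolding b_def using F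
    by (meson norm_triangle_ineq mult_left_mono order_trans)
  have lin: "linear ((*v) ?A)" by simp
  have A3: "a * (L * (t (Suc k) - t k)) \<le> 1 / 2" using A(3) t by simp
  have ez: "a * norm (z (t k)) + norm b \<le> (a + f) * (norm (z (t k)) + norm (e (t k)))"
  proof -
    have "a * norm (z (t k)) + norm b
        \<le> a * (norm (z (t k)) + norm (e (t k))) + f * (norm (z (t k)) + norm (e (t k)))"
      using b A(2) by (intro add_mono mult_left_mono) auto
    then show ?thesis by (simp add: distrib_right)
  qed
  show "norm (z s) + norm (e s) \<le> (1 + 2 * h * (a + f)) * (norm (z (t k)) + norm (e (t k)))"
    if s: "s \<in> ?I" for s
  proof -
    have "norm (z s - z (t k)) \<le> 2 * h * (a * norm (z (t k)) + norm b)"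
      using affine_flow_bounds(1)[OF lin A(1,2) pos(1) A3 dz s] t by (simp add: h_def)
    moreover have "norm (e s - e (t k)) \<le> 2 * h * (a * norm (e (t k)))"
      using affine_flow_bounds(1)[OF lin A(1,2) pos(1) A3 de s] t by (simp add: h_def)
    ultimately have "norm (z s) + norm (e s) \<le> norm (z (t k)) + norm (e (t k))
        + 2 * h * (a * norm (z (t k)) + norm b + a * norm (e (t k)))"
      using norm_triangle_sub[of "z s" "z (t k)"] norm_triangle_sub[of "e s" "e (t k)"]
      by (simp add: algebra_simps)
    also have "\<dots> \<le> norm (z (t k)) + norm (e (t k))
        + 2 * h * ((a + f) * (norm (z (t k)) + norm (e (t k))))"
      using b h by (intro add_left_mono mult_left_mono) (auto simp: algebra_simps)
    finally show ?thesis by (simp add: algebra_simps)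
  qed
  \<comment> \<open>The plant state does not jump: \<open>t (Suc k)\<close> is positive, hence
    interior to \<open>{0..}\<close>, so the left limit of \<open>x\<close> is its value
    there.\<close>
  have "isCont x (t (Suc k))"
    using cont t by (intro continuous_on_interior[of "{0..}"]) (auto simp: interior_real_atLeast)
  then have x_left: "(x \<longlongrightarrow> x (t (Suc k))) (at_left (t (Suc k)))"
    unfolding isCont_def by (rule tendsto_within_subset) simp
  have "(z \<longlongrightarrow> z (t (Suc k))) (at_left (t (Suc k)))"
    using bounded_linear.tendsto[OF matrix_vector_mul_bounded_linear x_left, of ?S]
    by (simp add: z_def x_def)
  from affine_flow_left_limit[OF lin A(1,2) pos(1) A3 t(2) dz this]
  have "norm (z (t (Suc k)) - (z (t k) + h *\<^sub>R (A_mat *v z (t k) + b)))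
      \<le> 2 * a * h\<^sup>2 * (a * norm (z (t k)) + norm b)"
    using t by (simp add: h_def)
  also have "\<dots> \<le> 2 * a * h\<^sup>2 * ((a + f + g) * (norm (z (t k)) + norm (e (t k))))"
  proof (intro mult_left_mono)
    show "a * norm (z (t k)) + norm b \<le> (a + f + g) * (norm (z (t k)) + norm (e (t k)))"
      using ez G(2) by (simp add: distrib_right add_increasing2)
  qed (use A in auto)
  finally show "norm (z (t (Suc k)) - (z (t k) + h *\<^sub>R (A_mat *v z (t k) + (B_mat ** Kc) *v (z (t k) + e (t k)))))
      \<le> 2 * a * (a + f + g) * h\<^sup>2 * (norm (z (t k)) + norm (e (t k)))"
    by (simp only: b_def mult_ac)
  define em where "em = ?S *v (\<xi> - x (t (Suc k)))"
  have "(e \<longlongrightarrow> em) (at_left (t (Suc k)))"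
    using bounded_linear.tendsto[OF matrix_vector_mul_bounded_linear tendsto_diff[OF \<xi> x_left], of ?S]
    by (simp add: e_def em_def x_def xh_def)
  from affine_flow_left_limit[OF lin A(1,2) pos(1) A3 t(2) de this]
  have em: "norm (em - (e (t k) + h *\<^sub>R (A_mat *v e (t k)))) \<le> 2 * a * h\<^sup>2 * (a * norm (e (t k)))"
    using t by (simp add: h_def)
  have em_diff: "norm (em - e (t k)) \<le> 2 * a * h * norm (e (t k))"
  proof -
    have "norm (em - e (t k)) \<le> norm (em - (e (t k) + h *\<^sub>R (A_mat *v e (t k)))) + norm (h *\<^sub>R (A_mat *v e (t k)))"
      using norm_triangle_ineq[of "em - (e (t k) + h *\<^sub>R (A_mat *v e (t k)))" "h *\<^sub>R (A_mat *v e (t k))"]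
      by simp
    also have "\<dots> \<le> 2 * a * h\<^sup>2 * (a * norm (e (t k))) + h * (a * norm (e (t k)))"
      using em A(1)[of "e (t k)"] h by (intro add_mono) auto
    also have "\<dots> = (2 * (a * h) + 1) * (a * h * norm (e (t k)))"
      by (simp add: algebra_simps power2_eq_square)
    also have "\<dots> \<le> 2 * (a * h * norm (e (t k)))"
      using hA A h by (intro mult_right_mono) auto
    finally show ?thesis by (simp add: mult_ac)
  qed
  have "e (t (Suc k)) = em + ?S *v (xh (t (Suc k)) - \<xi>)"
    by (simp add: e_def em_def x_def xh_def flip: matrix_vector_right_distrib)
  also have "?S *v (xh (t (Suc k)) - \<xi>) = \<delta> *\<^sub>R (Ko *v (C_mat *v (\<xi> - x (t (Suc k)))))"
    using pos by (simp add: jump matrix_vector_mult_scaleR scaling_matrix_inv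
      matrix_vector_mult_diff_distrib)
  \<comment> \<open>Passing \<open>C_mat\<close> to scaled coordinates produces a factor
    \<open>L\<close>, which joins \<open>\<delta>\<close> to form \<open>h\<close>.\<close>
  also have "\<dots> = h *\<^sub>R ((Ko ** C_mat) *v em)"
    unfolding scaling_C_mat[OF pos(1), of "\<xi> - x (t (Suc k))"]
    by (simp add: h_def em_def matrix_vector_mult_scaleR mult.commute flip: matrix_vector_mul_assoc)
  finally have "e (t (Suc k)) - (e (t k) + h *\<^sub>R (A_mat *v e (t k) + (Ko ** C_mat) *v e (t k)))
      = (em - (e (t k) + h *\<^sub>R (A_mat *v e (t k)))) + h *\<^sub>R ((Ko ** C_mat) *v (em - e (t k)))"
    by (simp add: matrix_vector_mult_diff_distrib algebra_simps)
  also have "norm \<dots> \<le> 2 * a * h\<^sup>2 * (a * norm (e (t k))) + h * (g * (2 * a * h * norm (e (t k))))"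
  proof (rule norm_triangle_mono[OF em])
    have "norm ((Ko ** C_mat) *v (em - e (t k))) \<le> g * (2 * a * h * norm (e (t k)))"
      using G em_diff by (meson mult_left_mono order_trans)
    then show "norm (h *\<^sub>R ((Ko ** C_mat) *v (em - e (t k)))) \<le> h * (g * (2 * a * h * norm (e (t k))))"
      using h by simp
  qed
  also have "\<dots> = 2 * a * (a + g) * h\<^sup>2 * norm (e (t k))"
    by (simp add: power2_eq_square algebra_simps)
  also have "\<dots> \<le> 2 * a * (a + f + g) * h\<^sup>2 * norm (e (t k))"
    using A F by (intro mult_right_mono mult_left_mono) auto
  finally show "norm (e (t (Suc k)) - (e (t k) + h *\<^sub>R (A_mat *v e (t k) + (Ko ** C_mat) *v e (t k))))
      \<le> 2 * a * (a + f + g) * h\<^sup>2 * norm (e (t k))" .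
qed

text \<open>The change of coordinates is linear and invertible. \<open>P\<close> and
  \<open>Q\<close> may depend on \<open>L\<close>, hence on \<open>\<delta>\<close>: they enter the
  overshoot constant, but neither the decay factor nor the threshold for
  \<open>\<alpha>\<close>.\<close>

lemma scaled_norm_bounds:
  assumes "L > 0"
  obtains P Q where "P > 0" "Q > 0"
    "\<And>x xh :: real^'n::{finite,linorder}.
      norm (x, xh) \<le> P * (norm (scaling L *v x) + norm (scaling L *v (xh - x)))"
    "\<And>x xh :: real^'n::{finite,linorder}.
      norm (scaling L *v x) + norm (scaling L *v (xh - x)) \<le> Q * norm (x, xh)"
proof -
  let ?S = "scaling L :: real^'n::{finite,linorder}^'n::{finite,linorder}"
  obtain p where p: "p > 0" "\<And>v. norm (matrix_inv ?S *v v) \<le> p * norm v"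
    using linear_bounded_pos[of "(*v) (matrix_inv ?S)"] by auto
  obtain q where q: "q > 0" "\<And>v. norm (?S *v v) \<le> q * norm v"
    using linear_bounded_pos[of "(*v) ?S"] by auto
  have inv: "norm v \<le> p * norm (?S *v v)" for v
    using p(2)[of "?S *v v"] assms by (simp add: scaling_matrix_inv)
  show ?thesis
  proof (rule that[of "2 * p" "3 * q"])
    fix x xh :: "real^'n::{finite,linorder}"
    have "norm (x, xh) \<le> norm x + norm xh" by (rule norm_Pair_le)
    also have "\<dots> \<le> 2 * norm x + norm (xh - x)"
      using norm_triangle_sub[of xh x] by simp
    also have "\<dots> \<le> 2 * (p * norm (?S *v x)) + p * norm (?S *v (xh - x))"
      using inv by (intro add_mono mult_left_mono) auto
    also have "\<dots> \<le> 2 * p * (norm (?S *v x) + norm (?S *v (xh - x)))"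
      using p by (simp add: algebra_simps)
    finally show "norm (x, xh) \<le> 2 * p * (norm (?S *v x) + norm (?S *v (xh - x)))" .
    have "norm x \<le> norm (x, xh)" "norm xh \<le> norm (x, xh)"
      using norm_fst_le[of x xh] norm_snd_le[of xh x] by simp_all
    then have "norm x + norm (xh - x) \<le> 3 * norm (x, xh)"
      using norm_triangle_ineq4[of xh x] by simp
    then have "q * (norm x + norm (xh - x)) \<le> q * (3 * norm (x, xh))"
      using q(1) by (intro mult_left_mono) auto
    then show "norm (?S *v x) + norm (?S *v (xh - x)) \<le> 3 * q * norm (x, xh)"
      using q(2)[of x] q(2)[of "xh - x"] by (simp add: algebra_simps)
  qed (use p q in auto)
qed

theorem theorem1:
  fixes Kc :: "real^'n::{finite,linorder}^1" and Ko :: "real^1^'n::{finite,linorder}"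
  assumes "hurwitz (A_mat + B_mat ** Kc)"
    and "hurwitz (A_mat + Ko ** C_mat)"
  shows "\<exists>\<alpha>star>0. \<forall>\<alpha>\<in>{0<..<\<alpha>star}. \<forall>\<delta>>0.
    zero_globally_asymptotically_stable (closed_loop Kc Ko (\<alpha> / \<delta>) \<delta>)"
proof -
  let ?A = "A_mat :: real^'n::{finite,linorder}^'n::{finite,linorder}"
  obtain a where a: "a > 0" "\<And>v. norm (?A *v v) \<le> a * norm v"
    using linear_bounded_pos[of "(*v) ?A"] by auto
  obtain f where f: "f > 0" "\<And>v. norm ((B_mat ** Kc :: real^'n::{finite,linorder}^'n::{finite,linorder}) *v v) \<le> f * norm v"
    using linear_bounded_pos[of "(*v) (B_mat ** Kc :: real^'n::{finite,linorder}^'n::{finite,linorder})"] by auto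
  obtain g where g: "g > 0" "\<And>v. norm ((Ko ** C_mat :: real^'n::{finite,linorder}^'n::{finite,linorder}) *v v) \<le> g * norm v"
    using linear_bounded_pos[of "(*v) (Ko ** C_mat :: real^'n::{finite,linorder}^'n::{finite,linorder})"] by auto
  \<comment> \<open>This is the error constant of one sampling period. It depends only on the three
    matrices, so the threshold \<open>h0\<close> obtained from it is independent of
    \<open>\<delta>\<close>.\<close>
  define K where "K = 2 * a * (a + f + g)"
  have "K \<ge> 0" using a f g by (simp add: K_def)
  show ?thesis
  proof (rule cascade_contraction[OF assms \<open>K \<ge> 0\<close>])
    fix W :: "real^'n::{finite,linorder} \<Rightarrow> real^'n::{finite,linorder} \<Rightarrow> real" and c h0 J :: real
    assume pos: "c > 0" "h0 > 0" "J > 0" and ch0: "c * h0 \<le> 1"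
      and W_ge: "\<And>z e. norm z + norm e \<le> W z e"
      and W_le: "\<And>z e. W z e \<le> J * (norm z + norm e)"
      and contr: "\<And>h z e z' e'. \<lbrakk>0 < h; h < h0;
        norm (z' - (z + h *\<^sub>R (A_mat *v z + (B_mat ** Kc) *v (z + e)))) \<le> K * h\<^sup>2 * (norm z + norm e);
        norm (e' - (e + h *\<^sub>R (A_mat *v e + (Ko ** C_mat) *v e))) \<le> K * h\<^sup>2 * norm e\<rbrakk>
        \<Longrightarrow> W z' e' \<le> (1 - c * h) * W z e"
    \<comment> \<open>The bound \<open>h0\<close> serves the cascade contraction, and
      \<open>1 / (2 * a)\<close> the flow estimate within a period.\<close>
    have "zero_globally_asymptotically_stable (closed_loop Kc Ko (\<alpha> / \<delta>) \<delta>)"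
      if \<alpha>: "0 < \<alpha>" "\<alpha> < min h0 (1 / (2 * a))" and "\<delta> > 0" for \<alpha> \<delta>
    proof -
      define L where "L = \<alpha> / \<delta>"
      have L: "L > 0" "L * \<delta> = \<alpha>" using \<alpha> \<open>\<delta> > 0\<close> by (auto simp: L_def)
      have A3: "a * (L * \<delta>) \<le> 1 / 2" using \<alpha> a L by (simp add: field_simps)
      obtain P Q where PQ: "P > 0" "Q > 0"
        and P: "\<And>x xh :: real^'n::{finite,linorder}. norm (x, xh) \<le> P * (norm (scaling L *v x) + norm (scaling L *v (xh - x)))"
        and Q: "\<And>x xh :: real^'n::{finite,linorder}. norm (scaling L *v x) + norm (scaling L *v (xh - x)) \<le> Q * norm (x, xh)"
        using scaled_norm_bounds[OF L(1), where 'n = 'n] by metis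
      define q where "q = 1 - c * \<alpha>"
      have "c * \<alpha> < c * h0" using \<alpha> pos by simp
      then have "c * \<alpha> < 1" using ch0 by (rule less_le_trans)
      then have q: "0 < q" "q < 1" using \<alpha> pos by (simp_all add: q_def)
      define D where "D = 1 + 2 * \<alpha> * (a + f)"
      have D: "D > 0" using \<alpha> a f by (simp add: D_def add_pos_pos)
      have "zero_globally_asymptotically_stable (closed_loop Kc Ko L \<delta>)"
      \<comment> \<open>The factors of \<open>R\<close>, from right to left: \<open>Q\<close> passes
        to scaled coordinates, \<open>J\<close> bounds \<open>W\<close> at time 0, \<open>D\<close>
        covers growth within a period, and \<open>P\<close> returns to the original
        coordinates.\<close>
      proof (rule exponential_decay_imp_stable[where q = q and \<delta> = \<delta> and R = "P * (D * (J * Q))"])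
        show "P * (D * (J * Q)) > 0" using PQ D pos by simp
        fix w k s
        assume w: "w \<in> closed_loop Kc Ko L \<delta>"
          and s: "s \<in> {sample_time \<delta> k..<sample_time \<delta> (Suc k)}"
        define z where "z = (\<lambda>s. scaling L *v fst (w s))"
        define e where "e = (\<lambda>s. scaling L *v (snd (w s) - fst (w s)))"
        define t where "t = sample_time \<delta>"
        note step = closed_loop_sampling_interval[OF w L(1) \<open>\<delta> > 0\<close> a(2) less_imp_le[OF a(1)] A3
          f(2) less_imp_le[OF f(1)] g(2) less_imp_le[OF g(1)]
          L(2)[symmetric] t_def z_def e_def, folded D_def K_def]
        have W_step: "W (z (t (Suc i))) (e (t (Suc i))) \<le> q * W (z (t i)) (e (t i))" for i
          unfolding q_def using \<alpha> step(2,3)[of i] by (intro contr) auto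
        have "W (z (t i)) (e (t i)) \<le> q ^ i * W (z 0) (e 0)" for i
        proof (induction i)
          case (Suc i)
          have "W (z (t (Suc i))) (e (t (Suc i))) \<le> q * (q ^ i * W (z 0) (e 0))"
            using W_step[of i] mult_left_mono[OF Suc, of q] q by linarith
          then show ?case by (simp add: mult_ac)
        qed (simp add: t_def)
        then have "norm (z (t k)) + norm (e (t k)) \<le> q ^ k * W (z 0) (e 0)"
          using W_ge order_trans by blast
        also have "\<dots> \<le> q ^ k * (J * (Q * norm (w 0)))"
        proof (rule mult_left_mono)
          have "J * (norm (z 0) + norm (e 0)) \<le> J * (Q * norm (w 0))"
            using Q[of "fst (w 0)" "snd (w 0)"] pos by (intro mult_left_mono) (auto simp: z_def e_def)
          with W_le show "W (z 0) (e 0) \<le> J * (Q * norm (w 0))" by (rule order_trans)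
        qed (use q in simp)
        finally have "P * (D * (norm (z (t k)) + norm (e (t k))))
            \<le> P * (D * (q ^ k * (J * (Q * norm (w 0)))))"
          using PQ D by (intro mult_left_mono) auto
        moreover have "P * (norm (z s) + norm (e s)) \<le> P * (D * (norm (z (t k)) + norm (e (t k))))"
          using step(1)[of s k] s PQ by (intro mult_left_mono) (auto simp: t_def)
        moreover have "norm (w s) \<le> P * (norm (z s) + norm (e s))"
          using P[of "fst (w s)" "snd (w s)"] by (simp add: z_def e_def)
        ultimately show "norm (w s) \<le> P * (D * (J * Q)) * q ^ k * norm (w 0)"
          by (simp add: mult_ac)
      qed (use zero_in_closed_loop \<open>\<delta> > 0\<close> q in auto)
      then show ?thesis by (simp add: L_def)
    qed
    moreover have "min h0 (1 / (2 * a)) > 0" using pos a by simp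
    ultimately show ?thesis
      by (intro exI[of _ "min h0 (1 / (2 * a))"]) auto
  qed
qed

end
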